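(* Let $D$ be a digraph whose underlying graph $G$ contains no subdivision of the Bean Graph, and let $vw$ be an edge of $D$. Then there is either a directed cycle, a directed double ray, or a directed minimal non-empty nibble of $G$ containing $vw$.
   Context: The Bean Graph consists of a ray $S$ starting at a vertex $u$ together with a ray $R$ disjoint from $S$ such that $u$ is adjacent to every vertex of $R$. For a set $X$ of vertices of $G$ with vertex set $V$, the cut $U_X$ is the set of edges with one end in $X$ and the other in $V\setminus X$; it is a nibble if the induced subgraph $G[X]$ is rayless. A minimal non-empty nibble is a non-empty nibble containing no other non-empty nibble. A set of edges of the form $U_X$ is directed (in $D$) if either all its edges are directed from $X$ to $V\setminus X$ or all are directed from $V\setminus X$ to $X$. Directed cycles and directed double rays are cycles and double rays in which all edges are oriented consistently along the cycle/double ray. *)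

theory Defs
  imports "Graph_Theory.Digraph" "Graph_Theory.Arc_Walk"
begin

text \<open>
  Digraphs are the possibly infinite \<open>wf_digraph\<close>s, in which loops and parallel arcs are allowed.
  Accordingly, the underlying graph is a multigraph on the same edge set; the set of ends of an
  edge has one element (for a loop) or two.
\<close>

record ('v, 'e) multigraph =
  gverts :: "'v set"
  gedges :: "'e set"
  gends :: "'e \<Rightarrow> 'v set"

definition underlying :: "('v, 'e) pre_digraph \<Rightarrow> ('v, 'e) multigraph" where
  "underlying D = \<lparr>gverts = verts D, gedges = arcs D, gends = (\<lambda>e. {tail D e, head D e})\<rparr>"

definition induced :: "('v, 'e) multigraph \<Rightarrow> 'v set \<Rightarrow> ('v, 'e) multigraph" where
  "induced G X =
     \<lparr>gverts = gverts G \<inter> X, gedges = {e \<in> gedges G. gends G e \<subseteq> X}, gends = gends G\<rparr>"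

definition is_ray :: "('v, 'e) multigraph \<Rightarrow> (nat \<Rightarrow> 'v) \<Rightarrow> (nat \<Rightarrow> 'e) \<Rightarrow> bool" where
  "is_ray G r a \<longleftrightarrow> inj r \<and> range r \<subseteq> gverts G \<and>
     (\<forall>i. a i \<in> gedges G \<and> gends G (a i) = {r i, r (Suc i)})"

definition rayless :: "('v, 'e) multigraph \<Rightarrow> bool" where
  "rayless G \<longleftrightarrow> (\<nexists>r a. is_ray G r a)"

text \<open>A path is given by its list of vertices \<open>p\<close> and its list of edges \<open>q\<close>.\<close>

definition is_path :: "('v, 'e) multigraph \<Rightarrow> 'v list \<Rightarrow> 'e list \<Rightarrow> bool" where
  "is_path G p q \<longleftrightarrow> distinct p \<and> set p \<subseteq> gverts G \<and> set q \<subseteq> gedges G \<and>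
     length p = Suc (length q) \<and> (\<forall>i<length q. gends G (q ! i) = {p ! i, p ! Suc i})"

definition inner_verts :: "'v list \<Rightarrow> 'v set" where
  "inner_verts p = set (butlast (tl p))"

text \<open>
  \<open>G\<close> contains a subdivision of the loopless graph \<open>H\<close>: \<open>f\<close> gives the branch vertices, and the
  edge \<open>e\<close> of \<open>H\<close> is replaced by the path with vertices \<open>p e\<close> and edges \<open>q e\<close>. (For a loop of \<open>H\<close>
  one would have to use a cycle instead of a path.)
\<close>

definition contains_subdivision ::
    "('v, 'e) multigraph \<Rightarrow> ('w, 'd) multigraph \<Rightarrow> bool" where
  "contains_subdivision G H \<longleftrightarrow> (\<exists>f p q.
     inj_on f (gverts H) \<and> f ` gverts H \<subseteq> gverts G \<and>
     (\<forall>e\<in>gedges H. is_path G (p e) (q e) \<and> {hd (p e), last (p e)} = f ` gends H e \<and>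
        inner_verts (p e) \<inter> f ` gverts H = {}) \<and>
     (\<forall>e\<in>gedges H. \<forall>e'\<in>gedges H. e \<noteq> e' \<longrightarrow>
        inner_verts (p e) \<inter> inner_verts (p e') = {} \<and> set (q e) \<inter> set (q e') = {}))"

datatype bean_vertex = S nat | R nat

text \<open>The vertex \<open>u\<close> of the Bean Graph is \<open>S 0\<close>. Edges are identified with their sets of ends.\<close>

definition bean_graph :: "(bean_vertex, bean_vertex set) multigraph" where
  "bean_graph = \<lparr>gverts = UNIV,
     gedges = (\<Union>i. {{S i, S (Suc i)}, {R i, R (Suc i)}, {S 0, R i}}),
     gends = (\<lambda>e. e)\<rparr>"

definition edge_cut :: "('v, 'e) multigraph \<Rightarrow> 'v set \<Rightarrow> 'e set" where
  "edge_cut G X = {e \<in> gedges G. \<exists>x\<in>X. \<exists>y\<in>gverts G - X. gends G e = {x, y}}"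

definition nibble :: "('v, 'e) multigraph \<Rightarrow> 'e set \<Rightarrow> bool" where
  "nibble G F \<longleftrightarrow> (\<exists>X\<subseteq>gverts G. F = edge_cut G X \<and> rayless (induced G X))"

definition minimal_nonempty_nibble :: "('v, 'e) multigraph \<Rightarrow> 'e set \<Rightarrow> bool" where
  "minimal_nonempty_nibble G F \<longleftrightarrow> nibble G F \<and> F \<noteq> {} \<and>
     (\<forall>F'. nibble G F' \<and> F' \<noteq> {} \<and> F' \<subseteq> F \<longrightarrow> F' = F)"

definition directed_cut :: "('v, 'e) pre_digraph \<Rightarrow> 'e set \<Rightarrow> bool" where
  "directed_cut D F \<longleftrightarrow> (\<exists>X\<subseteq>verts D. F = edge_cut (underlying D) X \<and>
     ((\<forall>e\<in>F. tail D e \<in> X \<and> head D e \<in> verts D - X) \<or>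
      (\<forall>e\<in>F. tail D e \<in> verts D - X \<and> head D e \<in> X)))"

definition directed_double_ray ::
    "('v, 'e) pre_digraph \<Rightarrow> (int \<Rightarrow> 'v) \<Rightarrow> (int \<Rightarrow> 'e) \<Rightarrow> bool" where
  "directed_double_ray D r a \<longleftrightarrow> inj r \<and> range r \<subseteq> verts D \<and>
     (\<forall>i. a i \<in> arcs D \<and> tail D (a i) = r i \<and> head D (a i) = r (i + 1))"

end

theory Submission
  imports Defs
begin

text \<open>
  Let \<open>X\<close> be the set of vertices reachable from \<open>w\<close> by directed paths and \<open>Y\<close> the set of vertices
  from which \<open>v\<close> is reachable. If \<open>v \<in> X\<close>, there is a directed cycle through \<open>vw\<close>; otherwise \<open>X\<close>
  and \<open>Y\<close> are disjoint. Suppose first that both \<open>G[X]\<close> and \<open>G[Y]\<close> contain rays. If no directed ray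
  starts at \<open>w\<close>, a star-comb argument yields a vertex of \<open>X\<close> with an infinite fan inside \<open>X\<close> to a
  ray of \<open>G[X]\<close>; with a ray leading into \<open>G[Y]\<close> this gives a subdivision of the Bean Graph. Hence
  there are directed rays from \<open>w\<close> and, symmetrically, towards \<open>v\<close>, which form a directed double
  ray with \<open>vw\<close>.

  Finally suppose that, say, \<open>G[X]\<close> is rayless. Let \<open>C\<close> be the component of \<open>G[X]\<close> containing \<open>w\<close>
  and \<open>K\<close> the component of \<open>G - C\<close> containing \<open>v\<close>. All edges leaving \<open>C\<close> leave \<open>X\<close>, so a cut
  formed by some of them is directed. If \<open>K\<close> is rayless, its cut is a minimal nibble. Otherwise
  let \<open>Z\<close> be the union of \<open>C\<close> and all rayless components of \<open>G - C\<close>. A ray in \<open>Z\<close> would meet \<open>C\<close>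
  infinitely often, so the star-comb argument and a ray in \<open>K\<close> would again give a subdivision of
  the Bean Graph. Thus the cut of \<open>Z\<close> is a nibble, and it is minimal since the components on its
  other side all contain rays.
\<close>

section \<open>Rays and paths in relations\<close>

definition ray_in :: "'a rel \<Rightarrow> (nat \<Rightarrow> 'a) \<Rightarrow> bool" where
  "ray_in E r \<longleftrightarrow> inj r \<and> (\<forall>i. (r i, r (Suc i)) \<in> E)"

definition path_in :: "'a rel \<Rightarrow> 'a \<Rightarrow> 'a list \<Rightarrow> 'a \<Rightarrow> bool" where
  "path_in E x p y \<longleftrightarrow> p \<noteq> [] \<and> hd p = x \<and> last p = y \<and> distinct p \<and>
     successively (\<lambda>a b. (a, b) \<in> E) p"

lemma ray_in_Restr_iff: "ray_in (Restr E A) r \<longleftrightarrow> ray_in E r \<and> range r \<subseteq> A"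
  unfolding ray_in_def by auto

lemma ray_in_drop: "ray_in E r \<Longrightarrow> ray_in E (\<lambda>i. r (i + k))"
  unfolding ray_in_def inj_def by (metis add_Suc add_right_cancel)

lemma ray_in_case_nat:
  assumes "ray_in E r" "(x, r 0) \<in> E" "x \<notin> range r"
  shows "ray_in E (case_nat x r)"
  using assms unfolding ray_in_def inj_def by (auto split: nat.splits)

lemma ray_in_reachable:
  assumes "ray_in E r"
  shows "range r \<subseteq> E\<^sup>* `` {r 0}"
proof -
  have "(r 0, r n) \<in> E\<^sup>*" for n
    using assms unfolding ray_in_def by (induction n) (auto intro: rtrancl_into_rtrancl)
  then show ?thesis by blast
qed

lemma ray_in_eventually_avoids:
  assumes "ray_in E r" "finite (range r \<inter> F)"
  obtains N where "range (\<lambda>i. r (i + N)) \<inter> F = {}"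
proof -
  have "finite (r -` (range r \<inter> F))"
    using assms by (intro finite_vimageI) (auto simp: ray_in_def)
  then obtain N where "\<forall>i \<in> r -` (range r \<inter> F). i < N"
    unfolding finite_nat_set_iff_bounded by blast
  then have "range (\<lambda>i. r (i + N)) \<inter> F = {}"
    by fastforce
  then show thesis by (rule that)
qed

lemma ray_in_prepend_walk:
  assumes "(x, t 0) \<in> E\<^sup>*" "ray_in E t"
  shows "\<exists>s. ray_in E s \<and> s 0 = x \<and> finite (range s - range t)"
  using assms(1)
proof (induction rule: converse_rtrancl_induct)
  case base
  then show ?case using assms(2) by (intro exI[of _ t]) simp
next
  case (step x y)
  then obtain s where s: "ray_in E s" "s 0 = y" "finite (range s - range t)" by blast
  show ?case
  proof (cases "x \<in> range s")
    case True
    then obtain k where "x = s k" by blast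
    moreover have "finite (range (\<lambda>i. s (i + k)) - range t)"
      by (rule finite_subset[OF _ s(3)]) auto
    ultimately show ?thesis
      using ray_in_drop[OF s(1), of k] by (intro exI[of _ "\<lambda>i. s (i + k)"]) simp
  next
    case False
    then have "ray_in E (case_nat x s)"
      using ray_in_case_nat[OF s(1)] s(2) step.hyps(1) by simp
    moreover have "range (case_nat x s) - range t \<subseteq> insert x (range s - range t)"
      by (auto split: nat.splits)
    then have "finite (range (case_nat x s) - range t)"
      using s(3) by (simp add: finite_subset)
    ultimately show ?thesis by (intro exI[of _ "case_nat x s"]) simp
  qed
qed

lemma path_in_mono: "path_in E x p y \<Longrightarrow> E \<subseteq> E' \<Longrightarrow> path_in E' x p y"
  unfolding path_in_def by (auto intro: successively_mono)

lemma path_in_Restr_subset: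
  assumes "path_in (Restr E A) x p y" "x \<in> A"
  shows "set p \<subseteq> A"
proof -
  have "set p \<subseteq> A" if "successively (\<lambda>a b. (a, b) \<in> Restr E A) p" "p \<noteq> []" "hd p \<in> A" for p
    using that by (induction p rule: induct_list012) auto
  then show ?thesis using assms unfolding path_in_def by blast
qed

lemma path_in_to_first_hit:
  assumes "(x, u) \<in> E\<^sup>*" "u \<in> U"
  shows "\<exists>p y. path_in E x p y \<and> set p \<inter> U = {y}"
  using assms(1)
proof (induction rule: converse_rtrancl_induct)
  case base
  then show ?case using assms(2) by (intro exI[of _ "[u]"] exI[of _ u]) (auto simp: path_in_def)
next
  case (step x x')
  then obtain p y where p: "path_in E x' p y" "set p \<inter> U = {y}" by blast
  consider (hit) "x \<in> U" | (on_path) "x \<in> set p" "x \<notin> U" | (new) "x \<notin> set p" "x \<notin> U" by blast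
  then show ?case
  proof cases
    case hit
    then show ?thesis by (intro exI[of _ "[x]"] exI[of _ x]) (auto simp: path_in_def)
  next
    case on_path
    then obtain ys zs where p_split: "p = ys @ x # zs" by (meson split_list)
    then have "path_in E x (x # zs) y"
      using p(1) by (auto simp: path_in_def successively_append_iff)
    moreover have "set (x # zs) \<inter> U = {y}"
      using p p_split calculation last_in_set[of "x # zs"] by (auto simp: path_in_def)
    ultimately show ?thesis by blast
  next
    case new
    then have "path_in E x (x # p) y" "set (x # p) \<inter> U = {y}"
      using p step.hyps by (auto simp: path_in_def successively_Cons)
    then show ?thesis by blast
  qed
qed

lemma rtrancl_Restr_subset: "x \<in> A \<Longrightarrow> (Restr E A)\<^sup>* `` {x} \<subseteq> A"
  using Image_closed_trancl[of "Restr E A" A] by blast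

lemma rtrancl_Restr_reachable:
  assumes "(x, y) \<in> E\<^sup>*" "E\<^sup>* `` {x} \<subseteq> A"
  shows "(x, y) \<in> (Restr E A)\<^sup>*"
  using assms(1)
proof (induction rule: rtrancl_induct)
  case (step y z)
  then have "(y, z) \<in> Restr E A" using assms(2) by (blast intro: rtrancl_into_rtrancl)
  then show ?case using step.IH by (rule rtrancl_into_rtrancl[rotated])
qed simp

lemma rtrancl_leave:
  assumes "(x, u) \<in> E\<^sup>*" "u \<noteq> x"
  shows "\<exists>y. (x, y) \<in> E \<and> y \<noteq> x \<and> (y, u) \<in> (Restr E (- {x}))\<^sup>*"
  using assms
proof (induction rule: rtrancl_induct)
  case (step u u')
  show ?case
  proof (cases "u = x")
    case False
    then have "(u, u') \<in> Restr E (- {x})" using step by blast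
    then show ?thesis using step False by (meson rtrancl_into_rtrancl)
  qed (use step in blast)
qed simp

lemma rtrancl_avoids_or_meets:
  assumes "(y, u) \<in> E\<^sup>*"
  shows "(y \<notin> F \<and> (y, u) \<in> (Restr E (- F))\<^sup>*) \<or> (\<exists>z\<in>F. (y, z) \<in> E\<^sup>* \<and> (z, u) \<in> E\<^sup>*)"
  using assms
proof (induction rule: converse_rtrancl_induct)
  case (step y y')
  have "(y, y') \<in> Restr E (- F)" if "y \<notin> F" "y' \<notin> F"
    using that step.hyps(1) by blast
  then show ?case
    using step by (meson converse_rtrancl_into_rtrancl rtrancl.rtrancl_refl)
qed blast

section \<open>Domination\<close>

definition dominates :: "'a rel \<Rightarrow> 'a \<Rightarrow> 'a set \<Rightarrow> bool" where
  "dominates E c U \<longleftrightarrow>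
     (\<forall>F. finite F \<longrightarrow> c \<notin> F \<longrightarrow> (\<exists>u\<in>U - {c}. (c, u) \<in> (Restr E (- F))\<^sup>*))"

lemma dominates_mono:
  assumes "dominates E c U" "E \<subseteq> E'" "U - {c} \<subseteq> U'"
  shows "dominates E' c U'"
proof -
  have "(Restr E (- F))\<^sup>* \<subseteq> (Restr E' (- F))\<^sup>*" for F
    using assms(2) by (intro rtrancl_mono) blast
  then show ?thesis using assms(1,3) unfolding dominates_def by blast
qed

lemma dominates_delete_finite:
  assumes "dominates E c U" "finite K" "c \<notin> K"
  shows "dominates (Restr E (- K)) c (U - K)"
  unfolding dominates_def
proof (intro allI impI)
  fix F assume "finite F" "c \<notin> F"
  then obtain u where u: "u \<in> U - {c}" "(c, u) \<in> (Restr E (- (K \<union> F)))\<^sup>*"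
    using assms unfolding dominates_def by (metis Un_iff finite_UnI)
  moreover have "u \<notin> K"
    using rtrancl_Restr_subset[of c "- (K \<union> F)" E] u(2) assms(3) \<open>c \<notin> F\<close> by blast
  moreover have "Restr E (- (K \<union> F)) = Restr (Restr E (- K)) (- F)" by blast
  ultimately show "\<exists>u\<in>U - K - {c}. (c, u) \<in> (Restr (Restr E (- K)) (- F))\<^sup>*"
    by (metis DiffD1 DiffD2 DiffI)
qed

lemma dominates_Restr_reachable:
  assumes "dominates E c U" "E\<^sup>* `` {c} \<subseteq> A"
  shows "dominates (Restr E A) c U"
  unfolding dominates_def
proof (intro allI impI)
  fix F assume "finite F" "c \<notin> F"
  then obtain u where u: "u \<in> U - {c}" "(c, u) \<in> (Restr E (- F))\<^sup>*"
    using assms(1) unfolding dominates_def by blast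
  have "(Restr E (- F))\<^sup>* `` {c} \<subseteq> A"
    using assms(2) rtrancl_mono[of "Restr E (- F)" E] by blast
  with u(2) have "(c, u) \<in> (Restr (Restr E (- F)) A)\<^sup>*" by (rule rtrancl_Restr_reachable)
  moreover have "Restr (Restr E (- F)) A = Restr (Restr E A) (- F)" by blast
  ultimately show "\<exists>u\<in>U - {c}. (c, u) \<in> (Restr (Restr E A) (- F))\<^sup>*"
    using u(1) by auto
qed

text \<open>
  If only finitely much of \<open>U\<close> could be reached from each successor of \<open>x\<close> without returning to \<open>x\<close>,
  then a finite set separating \<open>x\<close> from \<open>U\<close> would let only finitely much of \<open>U\<close> be reached from \<open>x\<close>.
  Iterating the step to such a successor is the directed star-comb argument.
\<close>

lemma infinite_reachable_successor:
  assumes inf: "infinite (U \<inter> E\<^sup>* `` {x})" and ndom: "\<not> dominates E x U"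
  shows "\<exists>y. (x, y) \<in> E \<and> y \<noteq> x \<and> infinite (U \<inter> (Restr E (- {x}))\<^sup>* `` {y})"
proof (rule ccontr)
  assume no_successor: "\<not> ?thesis"
  let ?E' = "Restr E (- {x})"
  define reach where "reach y = U \<inter> ?E'\<^sup>* `` {y}" for y
  have fin: "finite (reach y)" if "(x, y) \<in> E" "y \<noteq> x" for y
    using no_successor that unfolding reach_def by blast
  obtain F where F: "finite F" "x \<notin> F" "\<And>u. u \<in> U - {x} \<Longrightarrow> (x, u) \<notin> (Restr E (- F))\<^sup>*"
    using ndom unfolding dominates_def by blast
  have "U \<inter> E\<^sup>* `` {x} \<subseteq> insert x (\<Union>z\<in>{z \<in> F. finite (reach z)}. reach z)"
  proof
    fix u assume u: "u \<in> U \<inter> E\<^sup>* `` {x}"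
    show "u \<in> insert x (\<Union>z\<in>{z \<in> F. finite (reach z)}. reach z)"
    proof (cases "u = x")
      case False
      then obtain y where y: "(x, y) \<in> E" "y \<noteq> x" "(y, u) \<in> ?E'\<^sup>*"
        using rtrancl_leave u by (metis IntD2 Image_singleton_iff)
      have "\<not> (y \<notin> F \<and> (y, u) \<in> (Restr ?E' (- F))\<^sup>*)"
      proof
        assume "y \<notin> F \<and> (y, u) \<in> (Restr ?E' (- F))\<^sup>*"
        then have "(x, y) \<in> Restr E (- F)" "(y, u) \<in> (Restr E (- F))\<^sup>*"
          using y(1) F(2) rtrancl_mono[of "Restr ?E' (- F)" "Restr E (- F)"] by blast+
        then have "(x, u) \<in> (Restr E (- F))\<^sup>*" by (rule converse_rtrancl_into_rtrancl)
        then show False using F(3)[of u] u False by blast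
      qed
      then obtain z where z: "z \<in> F" "(y, z) \<in> ?E'\<^sup>*" "(z, u) \<in> ?E'\<^sup>*"
        using rtrancl_avoids_or_meets[OF y(3)] by blast
      then have "reach z \<subseteq> reach y" unfolding reach_def by (auto intro: rtrancl_trans)
      then have "finite (reach z)" using fin[OF y(1,2)] by (rule finite_subset)
      then show ?thesis using z u unfolding reach_def by blast
    qed simp
  qed
  moreover have "finite (insert x (\<Union>z\<in>{z \<in> F. finite (reach z)}. reach z))" using F(1) by simp
  ultimately show False using inf finite_subset by blast
qed

lemma ray_by_extension:
  assumes start: "Q {} x"
    and extend: "\<And>F y. y \<notin> F \<Longrightarrow> Q F y \<Longrightarrow> \<exists>z. (y, z) \<in> E \<and> z \<notin> insert y F \<and> Q (insert y F) z"
  shows "\<exists>r. ray_in E r \<and> r 0 = x"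
proof -
  define extends where "extends r n y \<longleftrightarrow> (case n of 0 \<Rightarrow> y = x | Suc m \<Rightarrow> (r m, y) \<in> E) \<and>
      y \<notin> r ` {..<n} \<and> Q (r ` {..<n}) y" for r n y
  have "\<exists>r. \<forall>n. extends r n (r n)"
  proof (rule dependent_wellorder_choice)
    fix y n and r r' :: "nat \<Rightarrow> 'a"
    assume "\<And>m. m < n \<Longrightarrow> r m = r' m"
    then have "r ` {..<n} = r' ` {..<n}" by simp
    moreover have "(case n of 0 \<Rightarrow> y = x | Suc m \<Rightarrow> (r m, y) \<in> E) \<longleftrightarrow>
        (case n of 0 \<Rightarrow> y = x | Suc m \<Rightarrow> (r' m, y) \<in> E)"
      using \<open>\<And>m. m < n \<Longrightarrow> r m = r' m\<close> by (cases n) simp_all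
    ultimately show "extends r n y = extends r' n y" by (simp add: extends_def)
  next
    fix n r assume r: "\<And>m. m < n \<Longrightarrow> extends r m (r m)"
    show "\<exists>y. extends r n y"
    proof (cases n)
      case 0
      then show ?thesis using start by (simp add: extends_def)
    next
      case (Suc m)
      then have "r m \<notin> r ` {..<m}" "Q (r ` {..<m}) (r m)"
        using r[of m] by (simp_all add: extends_def)
      then obtain y where "(r m, y) \<in> E" "y \<notin> insert (r m) (r ` {..<m})"
        "Q (insert (r m) (r ` {..<m})) y"
        using extend by blast
      then show ?thesis using Suc by (auto simp: extends_def lessThan_Suc)
    qed
  qed
  then obtain r where r: "\<And>n. extends r n (r n)" by blast
  have "r i \<noteq> r j" if "i < j" for i j
    using r[of j] that unfolding extends_def by (metis image_eqI lessThan_iff)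
  then have "inj r" by (metis injI linorder_neqE_nat)
  moreover have "(r n, r (Suc n)) \<in> E" "r 0 = x" for n
    using r[of "Suc n"] r[of 0] by (simp_all add: extends_def)
  ultimately show ?thesis unfolding ray_in_def by blast
qed

lemma ray_or_dominating_vertex:
  assumes inf: "infinite (U \<inter> E\<^sup>* `` {x})"
  shows "(\<exists>r. ray_in E r \<and> r 0 = x) \<or> (\<exists>c\<in>E\<^sup>* `` {x}. dominates E c U)"
proof (rule disjCI)
  assume ndom: "\<not> (\<exists>c\<in>E\<^sup>* `` {x}. dominates E c U)"
  let ?Q = "\<lambda>F y. (x, y) \<in> E\<^sup>* \<and> infinite (U \<inter> (Restr E (- F))\<^sup>* `` {y})"
  show "\<exists>r. ray_in E r \<and> r 0 = x"
  proof (rule ray_by_extension[of ?Q])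
    show "?Q {} x" using inf by simp
  next
    fix F y assume y: "y \<notin> F" "?Q F y"
    let ?E = "Restr E (- F)"
    have "\<not> dominates ?E y U" using ndom y(2) dominates_mono[of ?E y U E U] by blast
    then obtain z where z: "(y, z) \<in> ?E" "z \<noteq> y" "infinite (U \<inter> (Restr ?E (- {y}))\<^sup>* `` {z})"
      using infinite_reachable_successor[of U ?E y] y(2) by blast
    have "Restr ?E (- {y}) = Restr E (- insert y F)" by blast
    then have "?Q (insert y F) z" using y(2) z by (auto intro: rtrancl_into_rtrancl)
    then show "\<exists>z. (y, z) \<in> E \<and> z \<notin> insert y F \<and> ?Q (insert y F) z" using z(1,2) by blast
  qed
qed

lemma disjoint_sequence_exists:
  assumes finite: "\<And>x. Q x \<Longrightarrow> finite (A x)"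
    and avoid: "\<And>K. finite K \<Longrightarrow> \<exists>x. Q x \<and> A x \<inter> K = {}"
  shows "\<exists>f :: nat \<Rightarrow> 'a. (\<forall>i. Q (f i)) \<and> (\<forall>i j. i \<noteq> j \<longrightarrow> A (f i) \<inter> A (f j) = {})"
proof -
  have "\<exists>f. \<forall>n::nat. Q (f n) \<and> A (f n) \<inter> (\<Union>i<n. A (f i)) = {}"
  proof (rule dependent_wellorder_choice)
    fix n :: nat and f
    assume "\<And>m. m < n \<Longrightarrow> Q (f m) \<and> A (f m) \<inter> (\<Union>i<m. A (f i)) = {}"
    then have "finite (\<Union>i<n. A (f i))" using finite by blast
    then show "\<exists>x. Q x \<and> A x \<inter> (\<Union>i<n. A (f i)) = {}" by (rule avoid)
  qed simp
  then obtain f where f: "\<forall>n::nat. Q (f n) \<and> A (f n) \<inter> (\<Union>i<n. A (f i)) = {}" ..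
  have "A (f i) \<inter> A (f j) = {}" if "i < j" for i j
    using f[rule_format, of j] that by blast
  then have "A (f i) \<inter> A (f j) = {}" if "i \<noteq> j" for i j
    using that by (metis Int_commute linorder_neqE_nat)
  then show ?thesis using f by blast
qed

lemma fan_if_dominates:
  assumes dom: "dominates E c U" and c: "c \<notin> U"
  obtains P y where "\<And>i. path_in E c (P i) (y i)" "\<And>i. set (P i) \<inter> U = {y i}"
    "\<And>i j :: nat. i \<noteq> j \<Longrightarrow> set (P i) \<inter> set (P j) = {c}"
proof -
  define fan_path where "fan_path p \<longleftrightarrow> path_in E c p (last p) \<and> set p \<inter> U = {last p}" for p
  have "\<exists>p. fan_path p \<and> (set p - {c}) \<inter> K = {}" if "finite K" for K
  proof -
    obtain u where u: "u \<in> U" "(c, u) \<in> (Restr E (- (K - {c})))\<^sup>*"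
      using dom \<open>finite K\<close> unfolding dominates_def by (metis Diff_iff finite_Diff insertI1)
    then obtain p y where p: "path_in (Restr E (- (K - {c}))) c p y" "set p \<inter> U = {y}"
      using path_in_to_first_hit by metis
    have "y = last p" using p(1) by (simp add: path_in_def)
    then have "fan_path p" using p path_in_mono[OF p(1), of E] unfolding fan_path_def by blast
    moreover have "set p \<subseteq> - (K - {c})" using path_in_Restr_subset[OF p(1)] by blast
    ultimately show ?thesis by blast
  qed
  then obtain P where P: "\<And>i. fan_path (P i)"
    and disj: "\<And>i j :: nat. i \<noteq> j \<Longrightarrow> (set (P i) - {c}) \<inter> (set (P j) - {c}) = {}"
    using disjoint_sequence_exists[of fan_path "\<lambda>p. set p - {c}"] by auto
  have "c \<in> set (P i)" for i
    using P[of i] unfolding fan_path_def path_in_def by (metis list.set_sel(1))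
  then have "set (P i) \<inter> set (P j) = {c}" if "i \<noteq> j" for i j using disj[OF that] by blast
  then show thesis using that[of P "\<lambda>i. last (P i)"] P unfolding fan_path_def by blast
qed

section \<open>Subdivisions in multigraphs\<close>

definition adj :: "('v, 'e) multigraph \<Rightarrow> 'v rel" where
  "adj G = {(x, y). \<exists>e\<in>gedges G. gends G e = {x, y}}"

definition wf_multigraph :: "('v, 'e) multigraph \<Rightarrow> bool" where
  "wf_multigraph G \<longleftrightarrow> (\<forall>e\<in>gedges G. gends G e \<subseteq> gverts G)"

lemma sym_adj: "sym (adj G)"
  unfolding sym_def adj_def by (simp add: insert_commute)

lemma adj_subset_verts: "wf_multigraph G \<Longrightarrow> adj G \<subseteq> gverts G \<times> gverts G"
  unfolding wf_multigraph_def adj_def by blast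

lemma ray_in_adj_verts: "wf_multigraph G \<Longrightarrow> ray_in (adj G) r \<Longrightarrow> range r \<subseteq> gverts G"
  using adj_subset_verts unfolding ray_in_def by blast

lemma path_in_adj_is_path:
  assumes G: "wf_multigraph G" and p: "path_in (adj G) x p y" and x: "x \<in> gverts G"
  shows "\<exists>q. is_path G p q"
proof -
  have "Restr (adj G) (gverts G) = adj G" using adj_subset_verts[OF G] by blast
  then have verts: "set p \<subseteq> gverts G" using path_in_Restr_subset[of "adj G" "gverts G"] p x by simp
  have "\<exists>e\<in>gedges G. gends G e = {p ! i, p ! Suc i}" if "Suc i < length p" for i
    using p successively_nth[OF _ that] unfolding path_in_def adj_def by blast
  then obtain a where "\<And>i. Suc i < length p \<Longrightarrow> a i \<in> gedges G \<and> gends G (a i) = {p ! i, p ! Suc i}"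
    by metis
  then have "is_path G p (map a [0..<length p - 1])"
    using p verts unfolding is_path_def path_in_def by (auto simp: Suc_pred')
  then show ?thesis by blast
qed

lemma is_path_edge_ends:
  assumes "is_path G p q" "a \<in> set q"
  obtains x y where "gends G a = {x, y}" "x \<noteq> y" "x \<in> set p" "y \<in> set p"
proof -
  obtain i where i: "i < length q" "a = q ! i" using assms(2) by (metis in_set_conv_nth)
  then have "gends G a = {p ! i, p ! Suc i}" "p ! i \<noteq> p ! Suc i" "p ! i \<in> set p" "p ! Suc i \<in> set p"
    using assms(1) unfolding is_path_def by (auto simp: nth_eq_iff_index_eq)
  then show thesis by (rule that)
qed

lemma is_path_edges_disjoint:
  assumes p: "is_path G p q" and p': "is_path G p' q'" and meet: "set p \<inter> set p' \<subseteq> {z}"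
  shows "set q \<inter> set q' = {}"
proof (rule ccontr)
  assume "\<not> ?thesis"
  then obtain a where a: "a \<in> set q" "a \<in> set q'" by blast
  obtain x y where xy: "gends G a = {x, y}" "x \<noteq> y" "x \<in> set p" "y \<in> set p"
    using is_path_edge_ends[OF p a(1)] .
  have "gends G a \<subseteq> set p'"
    using is_path_edge_ends[OF p' a(2)] by (metis empty_subsetI insert_subset)
  then have "{x, y} \<subseteq> {z}" using xy meet by auto
  then show False using xy(2) by simp
qed

lemma inner_verts_path_in:
  assumes "path_in E x p y"
  shows "inner_verts p = set p - {x, y}"
proof (cases p)
  case (Cons a p')
  then show ?thesis
    using assms by (cases p' rule: rev_cases) (auto simp: path_in_def inner_verts_def)
qed (use assms in \<open>simp add: path_in_def\<close>)

lemma contains_subdivision_if_paths: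
  assumes G: "wf_multigraph G"
    and f: "inj_on f (gverts H)" "f ` gverts H \<subseteq> gverts G"
    and edges: "bij_betw edge I (gedges H)"
    and ends: "\<And>i. i \<in> I \<Longrightarrow> gends H (edge i) = {src i, tgt i}" "\<And>i. i \<in> I \<Longrightarrow> src i \<in> gverts H"
    and path: "\<And>i. i \<in> I \<Longrightarrow> path_in (adj G) (f (src i)) (p i) (f (tgt i))"
    and branch: "\<And>i. i \<in> I \<Longrightarrow> set (p i) \<inter> f ` gverts H \<subseteq> {f (src i), f (tgt i)}"
    and meet: "\<And>i j. i \<in> I \<Longrightarrow> j \<in> I \<Longrightarrow> i \<noteq> j \<Longrightarrow> \<exists>x\<in>gverts H. set (p i) \<inter> set (p j) \<subseteq> {f x}"
  shows "contains_subdivision G H"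
proof -
  have "\<exists>q. is_path G (p i) q" if "i \<in> I" for i
    using path_in_adj_is_path[OF G path[OF that]] f(2) ends(2)[OF that] by blast
  then obtain q where q: "\<And>i. i \<in> I \<Longrightarrow> is_path G (p i) (q i)" by metis
  have inner: "inner_verts (p i) = set (p i) - {f (src i), f (tgt i)}" if "i \<in> I" for i
    using path[OF that] by (rule inner_verts_path_in)
  define index where "index = inv_into I edge"
  have index: "index e \<in> I" "edge (index e) = e" if "e \<in> gedges H" for e
    using edges that unfolding index_def by (auto simp: bij_betw_def inv_into_into f_inv_into_f)
  have sub: "is_path G (p (index e)) (q (index e)) \<and>
      {hd (p (index e)), last (p (index e))} = f ` gends H e \<and>
      inner_verts (p (index e)) \<inter> f ` gverts H = {}" if "e \<in> gedges H" for e
    using q[of "index e"] path[of "index e"] ends(1)[of "index e"] branch[of "index e"]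
      inner[of "index e"] index[OF that] unfolding path_in_def by auto
  have disj: "inner_verts (p (index e)) \<inter> inner_verts (p (index e')) = {} \<and>
      set (q (index e)) \<inter> set (q (index e')) = {}"
    if e: "e \<in> gedges H" "e' \<in> gedges H" "e \<noteq> e'" for e e'
  proof -
    have i: "index e \<in> I" "index e' \<in> I" "index e \<noteq> index e'" using index e by metis+
    obtain x where x: "x \<in> gverts H" "set (p (index e)) \<inter> set (p (index e')) \<subseteq> {f x}"
      using meet[OF i] by blast
    then have "inner_verts (p (index e)) \<inter> inner_verts (p (index e')) = {}"
      using branch[OF i(1)] unfolding inner[OF i(1)] inner[OF i(2)] by blast
    then show ?thesis using is_path_edges_disjoint[OF q[OF i(1)] q[OF i(2)] x(2)] by blast
  qed
  show ?thesis
    unfolding contains_subdivision_def using f sub disj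
    by (intro exI[of _ f] exI[of _ "p \<circ> index"] exI[of _ "q \<circ> index"]) simp
qed

section \<open>Subdivisions of the Bean Graph\<close>

datatype bean_edge = S_edge nat | R_edge nat | Spoke nat

fun bean_src :: "bean_edge \<Rightarrow> bean_vertex" where
  "bean_src (S_edge i) = S i"
| "bean_src (R_edge i) = R i"
| "bean_src (Spoke i) = S 0"

fun bean_tgt :: "bean_edge \<Rightarrow> bean_vertex" where
  "bean_tgt (S_edge i) = S (Suc i)"
| "bean_tgt (R_edge i) = R (Suc i)"
| "bean_tgt (Spoke i) = R i"

lemma bij_betw_bean_edges: "bij_betw (\<lambda>e. {bean_src e, bean_tgt e}) UNIV (gedges bean_graph)"
proof (rule bij_betw_imageI)
  show "inj (\<lambda>e. {bean_src e, bean_tgt e})"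
  proof (rule injI)
    fix e e' assume "{bean_src e, bean_tgt e} = {bean_src e', bean_tgt e'}"
    then show "e = e'" by (cases e; cases e') (auto simp: doubleton_eq_iff)
  qed
  have range_cases: "range g = (\<Union>i. {g (S_edge i), g (R_edge i), g (Spoke i)})"
    for g :: "bean_edge \<Rightarrow> bean_vertex set"
    by (auto, metis bean_edge.exhaust)
  show "range (\<lambda>e. {bean_src e, bean_tgt e}) = gedges bean_graph"
    unfolding range_cases by (simp add: bean_graph_def)
qed

lemma path_in_ray_segment:
  assumes "ray_in E r" "m \<le> n"
  shows "path_in E (r m) (map r [m..<Suc n]) (r n)"
proof -
  have "distinct (map r [m..<Suc n])"
    using assms(1) by (auto simp: distinct_map ray_in_def intro: inj_on_subset)
  moreover have "successively (\<lambda>x y. (x, y) \<in> E) (map r [m..<Suc n])"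
    using assms(1) by (simp add: successively_map successively_conv_nth ray_in_def del: upt_Suc)
  ultimately show ?thesis
    using assms(2) by (simp add: path_in_def hd_map last_map del: upt_Suc)
qed

lemma strict_mono_segments_meet:
  fixes n :: "nat \<Rightarrow> nat"
  assumes "strict_mono n" "i \<noteq> j"
  shows "{n i..n (Suc i)} \<inter> {n j..n (Suc j)} \<subseteq> {n (max i j)}"
proof (cases "i < j")
  case True
  then have "n (Suc i) \<le> n j" by (simp add: strict_mono_less_eq[OF assms(1)])
  then show ?thesis using True by (auto simp: max_def)
next
  case False
  then have "n (Suc j) \<le> n i" using assms(2) by (simp add: strict_mono_less_eq[OF assms(1)])
  then show ?thesis using False by (auto simp: max_def)
qed

locale ray_fan =
  fixes G :: "('v, 'e) multigraph" and s r :: "nat \<Rightarrow> 'v" and n :: "nat \<Rightarrow> nat"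
    and P :: "nat \<Rightarrow> 'v list"
  assumes wf: "wf_multigraph G"
    and ray_s: "ray_in (adj G) s" and ray_r: "ray_in (adj G) r"
    and rays_disjoint: "range s \<inter> range r = {}"
    and strict_mono_n: "strict_mono n"
    and spoke: "path_in (adj G) (s 0) (P i) (r (n i))"
    and spoke_meets_s: "set (P i) \<inter> range s = {s 0}"
    and spoke_meets_r: "set (P i) \<inter> range r = {r (n i)}"
    and spokes_meet: "i \<noteq> j \<Longrightarrow> set (P i) \<inter> set (P j) = {s 0}"
begin

fun branch_vertex :: "bean_vertex \<Rightarrow> 'v" where
  "branch_vertex (S i) = s i"
| "branch_vertex (R i) = r (n i)"

fun branch_path :: "bean_edge \<Rightarrow> 'v list" where
  "branch_path (S_edge i) = map s [i..<Suc (Suc i)]"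
| "branch_path (R_edge i) = map r [n i..<Suc (n (Suc i))]"
| "branch_path (Spoke i) = P i"

lemma set_branch_path:
  "set (branch_path (S_edge i)) = s ` {i..Suc i}"
  "set (branch_path (R_edge i)) = r ` {n i..n (Suc i)}"
  using strict_mono_less_eq[OF strict_mono_n, of i "Suc i"]
  by (auto simp: atLeastLessThanSuc_atLeastAtMost simp del: upt_Suc)

lemma ray_vertex_eq_iff: "s i = s j \<longleftrightarrow> i = j" "r i = r j \<longleftrightarrow> i = j" "s i \<noteq> r j"
  using ray_s ray_r rays_disjoint unfolding ray_in_def inj_def by blast+

lemma inj_branch_vertex: "inj branch_vertex"
proof (rule injI)
  fix x y assume "branch_vertex x = branch_vertex y"
  then show "x = y"
    by (cases x; cases y)
      (simp_all add: ray_vertex_eq_iff ray_vertex_eq_iff(3)[symmetric]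
        strict_mono_eq[OF strict_mono_n])
qed

lemma range_branch_vertex: "range branch_vertex \<subseteq> range s \<union> range r"
proof -
  have "branch_vertex x \<in> range s \<union> range r" for x by (cases x) auto
  then show ?thesis by blast
qed

lemma path_in_branch_path:
  "path_in (adj G) (branch_vertex (bean_src e)) (branch_path e) (branch_vertex (bean_tgt e))"
proof (cases e)
  case (R_edge i)
  then show ?thesis
    using path_in_ray_segment[OF ray_r] strict_mono_less_eq[OF strict_mono_n] by simp
qed (use path_in_ray_segment[OF ray_s] spoke in \<open>simp_all del: upt_Suc\<close>)

lemma branch_path_branch_vertices:
  "set (branch_path e) \<inter> range branch_vertex \<subseteq>
     {branch_vertex (bean_src e), branch_vertex (bean_tgt e)}"
proof -
  have "branch_vertex v = branch_vertex (bean_src e) \<or> branch_vertex v = branch_vertex (bean_tgt e)"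
    if v: "branch_vertex v \<in> set (branch_path e)" for v
  proof (cases e)
    case (S_edge i)
    then show ?thesis
      using v unfolding S_edge set_branch_path by (cases v) (auto simp: ray_vertex_eq_iff le_Suc_eq)
  next
    case (R_edge i)
    then show ?thesis
      using v unfolding R_edge set_branch_path
      by (cases v) (auto simp: ray_vertex_eq_iff strict_mono_less_eq[OF strict_mono_n] le_Suc_eq)
  next
    case (Spoke i)
    have "branch_vertex v \<in> range s \<union> range r" using range_branch_vertex by blast
    then show ?thesis using v spoke_meets_s[of i] spoke_meets_r[of i] by (auto simp: Spoke)
  qed
  then show ?thesis by blast
qed

lemma branch_paths_meet:
  assumes "e \<noteq> e'"
  shows "\<exists>x. set (branch_path e) \<inter> set (branch_path e') \<subseteq> {branch_vertex x}"
proof -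
  have S_S: "s ` {i..Suc i} \<inter> s ` {j..Suc j} \<subseteq> {branch_vertex (S (max i j))}" if "i \<noteq> j" for i j
    using image_mono[OF strict_mono_segments_meet[OF strict_mono_id that], of s] ray_s
    by (simp add: image_Int ray_in_def del: Int_atLeastAtMost)
  have R_R: "r ` {n i..n (Suc i)} \<inter> r ` {n j..n (Suc j)} \<subseteq> {branch_vertex (R (max i j))}"
    if "i \<noteq> j" for i j
    using image_mono[OF strict_mono_segments_meet[OF strict_mono_n that], of r] ray_r
    by (simp add: image_Int ray_in_def del: Int_atLeastAtMost)
  have S_R: "s ` I \<inter> r ` J = {}" for I J using rays_disjoint by blast
  have S_P: "s ` I \<inter> set (P j) \<subseteq> {branch_vertex (S 0)}" for I j
    using spoke_meets_s[of j] by auto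
  have R_P: "r ` I \<inter> set (P j) \<subseteq> {branch_vertex (R j)}" for I j
    using spoke_meets_r[of j] by auto
  have P_P: "set (P i) \<inter> set (P j) \<subseteq> {branch_vertex (S 0)}" if "i \<noteq> j" for i j
    using spokes_meet[OF that] by simp
  show ?thesis
    using assms S_S R_R S_R S_P R_P P_P
    by (cases e; cases e')
      (simp_all only: set_branch_path branch_path.simps(3), (metis Int_commute empty_subsetI)+)
qed

lemma contains_bean: "contains_subdivision G bean_graph"
proof (rule contains_subdivision_if_paths[OF wf _ _ bij_betw_bean_edges,
      where f = branch_vertex and p = branch_path])
  show "branch_vertex ` gverts bean_graph \<subseteq> gverts G"
    using range_branch_vertex ray_in_adj_verts[OF wf ray_s] ray_in_adj_verts[OF wf ray_r] by blast
qed (use inj_branch_vertex path_in_branch_path branch_path_branch_vertices branch_paths_meet in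
    \<open>simp_all add: bean_graph_def\<close>)

end

lemma contains_bean_if_dominated_ray:
  assumes G: "wf_multigraph G"
    and s: "ray_in (adj G) s" and r: "ray_in (adj G) r" and disj: "range s \<inter> range r = {}"
    and dom: "dominates (Restr (adj G) (- (range s - {s 0}))) (s 0) (range r)"
  shows "contains_subdivision G bean_graph"
proof -
  let ?E = "Restr (adj G) (- (range s - {s 0}))"
  obtain P y where P: "\<And>i. path_in ?E (s 0) (P i) (y i)" "\<And>i. set (P i) \<inter> range r = {y i}"
    "\<And>i j :: nat. i \<noteq> j \<Longrightarrow> set (P i) \<inter> set (P j) = {s 0}"
    using fan_if_dominates[OF dom] disj by blast
  have "\<exists>k. y i = r k" for i using P(2)[of i] by blast
  then obtain m where m: "\<And>i. y i = r (m i)" by metis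
  have "inj m"
  proof (rule injI, rule ccontr)
    fix i j assume "m i = m j" "i \<noteq> j"
    then have "r (m i) = s 0" using P(2)[of i] P(2)[of j] P(3)[of i j] m by auto
    then show False using disj by blast
  qed
  then have inf: "infinite (range m)" by (rule range_inj_infinite)
  define k where "k i = inv m (enumerate (range m) i)" for i
  have mk: "m (k i) = enumerate (range m) i" for i
    using enumerate_in_set[OF inf] unfolding k_def by (rule f_inv_into_f)
  have "ray_fan G s r (m \<circ> k) (P \<circ> k)"
  proof
    show mono: "strict_mono (m \<circ> k)"
      using strict_mono_enumerate[OF inf] by (simp add: mk comp_def)
    show "set ((P \<circ> k) i) \<inter> set ((P \<circ> k) j) = {s 0}" if "i \<noteq> j" for i j
      using P(3)[of "k i" "k j"] that strict_mono_eq[OF mono, of i j] by (metis comp_apply)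
    fix i
    show "path_in (adj G) (s 0) ((P \<circ> k) i) (r ((m \<circ> k) i))"
      using path_in_mono[OF P(1), of "adj G"] by (simp add: m)
    have "s 0 \<in> set (P (k i))" using P(1)[of "k i"] unfolding path_in_def by (metis list.set_sel(1))
    then show "set ((P \<circ> k) i) \<inter> range s = {s 0}"
      using path_in_Restr_subset[OF P(1), of "k i"] by auto
    show "set ((P \<circ> k) i) \<inter> range r = {r ((m \<circ> k) i)}" by (simp add: P(2) m)
  qed (use G s r disj in auto)
  then show ?thesis by (rule ray_fan.contains_bean)
qed

lemma ray_from_if_infinite_reachable:
  assumes G: "wf_multigraph G" and nobean: "\<not> contains_subdivision G bean_graph"
    and E: "E \<subseteq> adj G" "E\<^sup>* `` {x} \<subseteq> A"
    and r: "ray_in (adj G) r" "range r \<subseteq> A" and inf: "infinite (range r \<inter> E\<^sup>* `` {x})"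
    and t: "ray_in (adj G) t" "range t \<inter> A = {}" and conn: "(x, t 0) \<in> (adj G)\<^sup>*"
  shows "\<exists>\<rho>. ray_in E \<rho> \<and> \<rho> 0 = x"
proof (rule ccontr)
  assume "\<not> ?thesis"
  then obtain c where c: "(x, c) \<in> E\<^sup>*" "dominates E c (range r)"
    using ray_or_dominating_vertex[OF inf] by blast
  have reach: "E\<^sup>* `` {c} \<subseteq> A" using c(1) E(2) by (auto intro: rtrancl_trans)
  have "(c, x) \<in> (adj G)\<^sup>*"
    using symD[OF sym_rtrancl[OF sym_adj]] subsetD[OF rtrancl_mono[OF E(1)] c(1)] .
  then obtain s where s: "ray_in (adj G) s" "s 0 = c" "finite (range s - range t)"
    using ray_in_prepend_walk[of c t] conn t(1) by (meson rtrancl_trans)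
  have fin: "finite (A \<inter> range s)"
    by (rule finite_subset[OF _ s(3)]) (use t(2) in blast)
  then have "finite (range r \<inter> range s)"
    by (rule finite_subset[rotated]) (use r(2) in blast)
  then obtain N where N: "range (\<lambda>i. r (i + N)) \<inter> range s = {}"
    by (rule ray_in_eventually_avoids[OF r(1)])
  let ?r = "\<lambda>i. r (i + N)"
  let ?K = "(A \<inter> range s \<union> r ` {..<N}) - {c}"
  have "dominates (Restr (Restr E A) (- ?K)) c (range r - ?K)"
    using dominates_Restr_reachable[OF c(2) reach] fin by (intro dominates_delete_finite) auto
  moreover have "Restr (Restr E A) (- ?K) \<subseteq> Restr (adj G) (- (range s - {c}))"
    using E(1) by blast
  moreover have "r i \<in> range ?r" if "r i \<notin> ?K" "r i \<noteq> c" for i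
    using that rangeI[of ?r "i - N"] by (cases "i < N") auto
  then have "range r - ?K - {c} \<subseteq> range ?r" by blast
  ultimately have "dominates (Restr (adj G) (- (range s - {c}))) c (range ?r)"
    by (rule dominates_mono)
  then have "contains_subdivision G bean_graph"
    using contains_bean_if_dominated_ray[OF G s(1) ray_in_drop[OF r(1)]] N s(2) by blast
  then show False using nobean by contradiction
qed

section \<open>Components and cuts\<close>

lemma wf_multigraph_induced: "wf_multigraph G \<Longrightarrow> wf_multigraph (induced G X)"
  unfolding wf_multigraph_def induced_def by auto

lemma adj_induced: "adj (induced G X) = Restr (adj G) X"
  unfolding adj_def induced_def by auto

lemma rayless_iff_no_ray_in:
  assumes "wf_multigraph G"
  shows "rayless G \<longleftrightarrow> (\<nexists>r. ray_in (adj G) r)"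
proof -
  have "ray_in (adj G) r \<longleftrightarrow> (\<exists>a. is_ray G r a)" for r
  proof
    assume r: "ray_in (adj G) r"
    then have "\<forall>i. \<exists>e. e \<in> gedges G \<and> gends G e = {r i, r (Suc i)}"
      unfolding ray_in_def adj_def by blast
    then obtain a where "\<forall>i. a i \<in> gedges G \<and> gends G (a i) = {r i, r (Suc i)}" by metis
    then show "\<exists>a. is_ray G r a"
      using r ray_in_adj_verts[OF assms r] unfolding is_ray_def ray_in_def by blast
  next
    assume "\<exists>a. is_ray G r a"
    then show "ray_in (adj G) r" unfolding is_ray_def ray_in_def adj_def by blast
  qed
  then show ?thesis unfolding rayless_def by blast
qed

lemma rayless_induced_iff:
  "wf_multigraph G \<Longrightarrow> rayless (induced G X) \<longleftrightarrow> (\<nexists>r. ray_in (adj G) r \<and> range r \<subseteq> X)"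
  using rayless_iff_no_ray_in[OF wf_multigraph_induced] by (simp only: adj_induced ray_in_Restr_iff)

lemma rayless_induced_subset:
  "wf_multigraph G \<Longrightarrow> rayless (induced G X) \<Longrightarrow> Y \<subseteq> X \<Longrightarrow> rayless (induced G Y)"
  unfolding rayless_induced_iff by blast

text \<open>For \<open>x \<notin> A\<close> this is \<open>{x}\<close>.\<close>

definition component :: "('v, 'e) multigraph \<Rightarrow> 'v set \<Rightarrow> 'v \<Rightarrow> 'v set" where
  "component G A x = (Restr (adj G) A)\<^sup>* `` {x}"

definition connected_set :: "('v, 'e) multigraph \<Rightarrow> 'v set \<Rightarrow> bool" where
  "connected_set G C \<longleftrightarrow> (\<forall>x\<in>C. component G C x = C)"

lemma component_self: "x \<in> component G A x"
  by (simp add: component_def)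

lemma component_subset: "x \<in> A \<Longrightarrow> component G A x \<subseteq> A"
  unfolding component_def by (rule rtrancl_Restr_subset)

lemma component_eq:
  assumes "y \<in> component G A x"
  shows "component G A y = component G A x"
proof -
  have "sym (Restr (adj G) A)" using sym_adj[of G] by (auto simp: sym_def)
  then have "(y, x) \<in> (Restr (adj G) A)\<^sup>*"
    using assms symD[OF sym_rtrancl] by (auto simp: component_def)
  then show ?thesis using assms by (auto simp: component_def intro: rtrancl_trans)
qed

lemma component_closed:
  assumes "x \<in> A" "y \<in> component G A x" "(y, z) \<in> adj G" "z \<in> A"
  shows "z \<in> component G A x"
proof -
  have "(y, z) \<in> Restr (adj G) A" using assms component_subset[OF assms(1)] by blast
  then show ?thesis using assms(2) by (auto simp: component_def intro: rtrancl_into_rtrancl)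
qed

lemma component_subset_verts:
  assumes "wf_multigraph G" "x \<in> gverts G"
  shows "component G A x \<subseteq> gverts G"
  unfolding component_def
  using adj_subset_verts[OF assms(1)] assms(2) Image_closed_trancl[of "Restr (adj G) A" "gverts G"]
  by blast

lemma connected_set_component:
  assumes "x \<in> A"
  shows "connected_set G (component G A x)"
  unfolding connected_set_def
proof (intro ballI equalityI)
  let ?C = "component G A x"
  fix y assume y: "y \<in> ?C"
  then show "component G ?C y \<subseteq> ?C" by (rule component_subset)
  have reach: "(Restr (adj G) A)\<^sup>* `` {y} = ?C"
    using component_eq[OF y] by (simp add: component_def)
  have "Restr (Restr (adj G) A) ?C = Restr (adj G) ?C"
    using component_subset[OF assms] by (rule Restr_subset)
  then show "?C \<subseteq> component G ?C y"
    using rtrancl_Restr_reachable[of y _ "Restr (adj G) A" ?C] reach by (auto simp: component_def)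
qed

definition edges_between :: "('v, 'e) multigraph \<Rightarrow> 'v set \<Rightarrow> 'v set \<Rightarrow> 'e set" where
  "edges_between G A B = {e \<in> gedges G. \<exists>a\<in>A. \<exists>b\<in>B. gends G e = {a, b}}"

lemma in_edge_cut_iff:
  assumes "wf_multigraph G" "e \<in> gedges G" "gends G e = {x, y}"
  shows "e \<in> edge_cut G X \<longleftrightarrow> (x \<in> X) \<noteq> (y \<in> X)"
proof -
  have "{x, y} \<subseteq> gverts G" using assms unfolding wf_multigraph_def by metis
  then show ?thesis using assms(2,3) unfolding edge_cut_def by (auto simp: doubleton_eq_iff)
qed

lemma edge_cut_complement: "X \<subseteq> gverts G \<Longrightarrow> edge_cut G (gverts G - X) = edge_cut G X"
  unfolding edge_cut_def by (auto simp: insert_commute)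

lemma edge_cut_component_side:
  assumes G: "wf_multigraph G" and cut: "edge_cut G Y \<subseteq> edges_between G C (- C)"
    and A: "A \<subseteq> C \<or> A \<subseteq> - C" and y: "y \<in> component G A x"
  shows "x \<in> Y \<longleftrightarrow> y \<in> Y"
proof -
  have "(x, y) \<in> (Restr (adj G) A)\<^sup>*" using y by (simp add: component_def)
  then show ?thesis
  proof (induction rule: rtrancl_induct)
    case (step y z)
    then obtain e where e: "e \<in> gedges G" "gends G e = {y, z}" by (auto simp: adj_def)
    then have "e \<notin> edges_between G C (- C)"
      using A step.hyps(2) by (auto simp: edges_between_def doubleton_eq_iff)
    then show ?case using step.IH cut in_edge_cut_iff[OF G e] by blast
  qed simp
qed

lemma edge_cut_union_of_components:
  assumes G: "wf_multigraph G" and B: "B \<subseteq> - C" "\<And>b. b \<in> B \<Longrightarrow> component G (- C) b \<subseteq> B"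
  shows "edge_cut G B \<subseteq> edges_between G C B"
proof
  fix e assume "e \<in> edge_cut G B"
  then obtain a b where e: "e \<in> gedges G" "gends G e = {b, a}" "b \<in> B" "a \<notin> B"
    unfolding edge_cut_def by blast
  then have "(b, a) \<in> adj G" unfolding adj_def by blast
  then have "a \<in> C"
    using component_closed[of b "- C" b G a] component_self[of b G "- C"] e(3,4) B by blast
  then show "e \<in> edges_between G C B"
    using e unfolding edges_between_def by (auto simp: insert_commute)
qed

lemma edges_between_component_outside:
  assumes "x \<in> X" "B \<inter> component G X x = {}"
  shows "edges_between G (component G X x) B \<subseteq> edges_between G (X - B) (B - X)"
proof
  fix e assume "e \<in> edges_between G (component G X x) B"
  then obtain a b where e: "e \<in> gedges G" "gends G e = {a, b}" "a \<in> component G X x" "b \<in> B"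
    unfolding edges_between_def by blast
  then have "(a, b) \<in> adj G" unfolding adj_def by blast
  then have "b \<notin> X" using component_closed[OF assms(1) e(3)] assms(2) e(4) by blast
  moreover have "a \<in> X - B" using component_subset[OF assms(1)] e(3) assms(2) by blast
  ultimately show "e \<in> edges_between G (X - B) (B - X)"
    using e unfolding edges_between_def by blast
qed

section \<open>Minimal nibbles\<close>

lemma minimal_nonempty_nibbleI:
  assumes G: "wf_multigraph G" and F: "nibble G F" "F \<noteq> {}" "F \<subseteq> edges_between G C B"
    and C: "connected_set G C" and B: "B \<subseteq> - C"
    and same_side: "\<And>Y b b'. rayless (induced G Y) \<Longrightarrow> edge_cut G Y \<subseteq> edges_between G C (- C) \<Longrightarrow>
      b \<in> B \<Longrightarrow> b' \<in> B \<Longrightarrow> b \<in> Y \<longleftrightarrow> b' \<in> Y"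
  shows "minimal_nonempty_nibble G F"
proof -
  have "F \<subseteq> F'" if F': "nibble G F'" "F' \<noteq> {}" "F' \<subseteq> F" for F'
  proof
    fix f assume "f \<in> F"
    then obtain a b where f: "f \<in> gedges G" "gends G f = {a, b}" "a \<in> C" "b \<in> B"
      using F(3) unfolding edges_between_def by blast
    obtain Y where Y: "F' = edge_cut G Y" "rayless (induced G Y)"
      using F'(1) unfolding nibble_def by blast
    have cut: "edge_cut G Y \<subseteq> edges_between G C (- C)"
      using F'(3) F(3) B unfolding Y(1) edges_between_def by blast
    obtain f' where "f' \<in> F'" using F'(2) by blast
    moreover from this obtain a' b'
      where f': "f' \<in> gedges G" "gends G f' = {a', b'}" "a' \<in> C" "b' \<in> B"
      using F'(3) F(3) unfolding edges_between_def by blast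
    ultimately have "(a' \<in> Y) \<noteq> (b' \<in> Y)"
      unfolding Y(1) by (simp add: in_edge_cut_iff[OF G f'(1,2)])
    moreover have "a \<in> component G C a'" using C f(3) f'(3) unfolding connected_set_def by blast
    then have "a' \<in> Y \<longleftrightarrow> a \<in> Y" using edge_cut_component_side[OF G cut] by blast
    moreover have "b' \<in> Y \<longleftrightarrow> b \<in> Y" using same_side[OF Y(2) cut f'(4) f(4)] .
    ultimately show "f \<in> F'" unfolding Y(1) by (simp add: in_edge_cut_iff[OF G f(1,2)])
  qed
  then show ?thesis using F(1,2) unfolding minimal_nonempty_nibble_def by blast
qed

lemma minimal_nibble_rayless_component:
  assumes G: "wf_multigraph G" and C: "connected_set G C" and y: "y \<in> gverts G - C"
    and rayless: "rayless (induced G (component G (- C) y))"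
    and nonempty: "edge_cut G (component G (- C) y) \<noteq> {}"
  shows "minimal_nonempty_nibble G (edge_cut G (component G (- C) y))"
proof (rule minimal_nonempty_nibbleI[OF G _ nonempty _ C])
  let ?K = "component G (- C) y"
  show K: "?K \<subseteq> - C" using y by (intro component_subset) simp
  show "nibble G (edge_cut G ?K)"
    unfolding nibble_def using rayless component_subset_verts[OF G, of y "- C"] y by blast
  show "edge_cut G ?K \<subseteq> edges_between G C ?K"
    by (rule edge_cut_union_of_components[OF G K]) (simp add: component_eq)
  show "b \<in> Y \<longleftrightarrow> b' \<in> Y"
    if "edge_cut G Y \<subseteq> edges_between G C (- C)" "b \<in> ?K" "b' \<in> ?K" for Y b b'
    using edge_cut_component_side[OF G that(1), of "- C" _ y] that(2,3) by blast
qed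

definition ray_side :: "('v, 'e) multigraph \<Rightarrow> 'v set \<Rightarrow> 'v set" where
  "ray_side G C = {z \<in> gverts G - C. \<not> rayless (induced G (component G (- C) z))}"

lemma component_subset_ray_side:
  assumes "wf_multigraph G" "z \<in> ray_side G C"
  shows "component G (- C) z \<subseteq> ray_side G C"
proof
  fix z' assume z': "z' \<in> component G (- C) z"
  have "z' \<in> gverts G - C"
    using assms z' component_subset_verts[OF assms(1)] component_subset[of z "- C" G]
    unfolding ray_side_def by blast
  then show "z' \<in> ray_side G C" using assms(2) component_eq[OF z'] by (simp add: ray_side_def)
qed

lemma minimal_nibble_ray_side:
  assumes G: "wf_multigraph G" and C: "connected_set G C"
    and rayless: "rayless (induced G (gverts G - ray_side G C))"
    and nonempty: "edge_cut G (ray_side G C) \<noteq> {}"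
  shows "minimal_nonempty_nibble G (edge_cut G (ray_side G C))"
proof (rule minimal_nonempty_nibbleI[OF G _ nonempty _ C])
  show side: "ray_side G C \<subseteq> - C" unfolding ray_side_def by blast
  have "edge_cut G (ray_side G C) = edge_cut G (gverts G - ray_side G C)"
    by (rule edge_cut_complement[symmetric]) (auto simp: ray_side_def)
  then show "nibble G (edge_cut G (ray_side G C))" unfolding nibble_def using rayless by blast
  show "edge_cut G (ray_side G C) \<subseteq> edges_between G C (ray_side G C)"
    by (rule edge_cut_union_of_components[OF G side component_subset_ray_side[OF G]])
  have "b \<notin> Y" if Y: "rayless (induced G Y)" "edge_cut G Y \<subseteq> edges_between G C (- C)"
    and b: "b \<in> ray_side G C" for Y b
  proof
    assume "b \<in> Y"
    then have "component G (- C) b \<subseteq> Y" using edge_cut_component_side[OF G Y(2), of "- C"] by blast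
    then show False using rayless_induced_subset[OF G Y(1)] b by (simp add: ray_side_def)
  qed
  then show "b \<in> Y \<longleftrightarrow> b' \<in> Y" if "rayless (induced G Y)" "edge_cut G Y \<subseteq> edges_between G C (- C)"
    "b \<in> ray_side G C" "b' \<in> ray_side G C" for Y b b'
    using that by blast
qed

lemma ray_outside_ray_side_meets_infinitely:
  assumes G: "wf_multigraph G" and r: "ray_in (adj G) r" "range r \<inter> ray_side G C = {}"
  shows "infinite (range r \<inter> C)"
proof
  assume "finite (range r \<inter> C)"
  then obtain N where N: "range (\<lambda>i. r (i + N)) \<inter> C = {}"
    by (rule ray_in_eventually_avoids[OF r(1)])
  let ?r = "\<lambda>i. r (i + N)"
  have tail: "ray_in (adj G) ?r" using r(1) by (rule ray_in_drop)
  then have "ray_in (Restr (adj G) (- C)) ?r" using N unfolding ray_in_Restr_iff by blast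
  from ray_in_reachable[OF this] have "range ?r \<subseteq> component G (- C) (r N)"
    by (simp add: component_def)
  then have "\<not> rayless (induced G (component G (- C) (r N)))"
    using tail unfolding rayless_induced_iff[OF G] by blast
  moreover have "r N \<in> gverts G" "r N \<notin> C"
    using ray_in_adj_verts[OF G r(1)] N rangeI[of ?r 0] by auto
  ultimately have "r N \<in> ray_side G C" by (simp add: ray_side_def)
  then show False using r(2) by blast
qed

lemma rayless_outside_ray_side:
  assumes G: "wf_multigraph G" and nobean: "\<not> contains_subdivision G bean_graph"
    and C: "connected_set G C" "rayless (induced G C)"
    and xy: "x \<in> C" "(x, y) \<in> adj G" "y \<in> ray_side G C"
  shows "rayless (induced G (gverts G - ray_side G C))"
  unfolding rayless_induced_iff[OF G]
proof
  let ?Z = "gverts G - ray_side G C"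
  assume "\<exists>r. ray_in (adj G) r \<and> range r \<subseteq> ?Z"
  then obtain r where r: "ray_in (adj G) r" "range r \<subseteq> ?Z" by blast
  obtain t where t: "ray_in (adj G) t" "range t \<subseteq> component G (- C) y"
    using xy(3) unfolding ray_side_def rayless_induced_iff[OF G] by blast
  have reach: "(Restr (adj G) C)\<^sup>* `` {x} = C"
    using C(1) xy(1) unfolding connected_set_def component_def by blast
  have "C \<subseteq> ?Z"
    using component_subset_verts[OF G, of x C] adj_subset_verts[OF G] xy C(1)
    unfolding connected_set_def ray_side_def by blast
  moreover have "infinite (range r \<inter> C)"
    by (rule ray_outside_ray_side_meets_infinitely[OF G r(1)]) (use r(2) in blast)
  moreover have "range t \<inter> ?Z = {}"
    using t(2) component_subset_ray_side[OF G xy(3)] by blast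
  moreover have "(y, t 0) \<in> (adj G)\<^sup>*"
    using t(2) rtrancl_mono[of "Restr (adj G) (- C)" "adj G"] unfolding component_def by blast
  then have "(x, t 0) \<in> (adj G)\<^sup>*" by (rule converse_rtrancl_into_rtrancl[OF xy(2)])
  ultimately have "\<exists>\<rho>. ray_in (Restr (adj G) C) \<rho>"
    using ray_from_if_infinite_reachable[OF G nobean, of "Restr (adj G) C" x ?Z r t] r t(1) reach
    by auto
  then show False using C(2) unfolding rayless_induced_iff[OF G] ray_in_Restr_iff by blast
qed

lemma minimal_nibble_of_components:
  assumes G: "wf_multigraph G" and nobean: "\<not> contains_subdivision G bean_graph"
    and C: "connected_set G C" "rayless (induced G C)"
    and xy: "x \<in> C" "(x, y) \<in> adj G" "y \<notin> C"
  shows "\<exists>B\<subseteq>gverts G - C. y \<in> B \<and> (\<forall>b\<in>B. component G (- C) b \<subseteq> B) \<and>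
    minimal_nonempty_nibble G (edge_cut G B)"
proof -
  let ?K = "component G (- C) y" and ?R = "ray_side G C"
  have y: "y \<in> gverts G - C" using xy adj_subset_verts[OF G] by blast
  have nonempty: "edge_cut G B \<noteq> {}" if "y \<in> B" "B \<subseteq> - C" for B
  proof -
    obtain e where "e \<in> gedges G" "gends G e = {x, y}" using xy(2) by (auto simp: adj_def)
    then have "e \<in> edge_cut G B" using in_edge_cut_iff[OF G] xy(1) that by blast
    then show ?thesis by blast
  qed
  show ?thesis
  proof (cases "rayless (induced G ?K)")
    case True
    have "y \<in> ?K" by (rule component_self)
    moreover have "?K \<subseteq> gverts G - C"
      using component_subset_verts[OF G, of y] component_subset[of y "- C" G] y by blast
    moreover have "\<forall>b\<in>?K. component G (- C) b \<subseteq> ?K" by (simp add: component_eq)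
    ultimately show ?thesis
      using minimal_nibble_rayless_component[OF G C(1) y True nonempty] by blast
  next
    case False
    then have "y \<in> ?R" using y by (simp add: ray_side_def)
    moreover have "?R \<subseteq> gverts G - C" by (auto simp: ray_side_def)
    moreover have "\<forall>b\<in>?R. component G (- C) b \<subseteq> ?R" by (simp add: component_subset_ray_side[OF G])
    moreover have "rayless (induced G (gverts G - ?R))"
      by (rule rayless_outside_ray_side[OF G nobean C xy(1,2)]) fact
    ultimately show ?thesis using minimal_nibble_ray_side[OF G C(1) _ nonempty] by blast
  qed
qed

lemma minimal_nibble_in_rayless_cut:
  assumes G: "wf_multigraph G" and nobean: "\<not> contains_subdivision G bean_graph"
    and X: "rayless (induced G X)" and e: "e \<in> edge_cut G X"
  shows "\<exists>B\<subseteq>gverts G. minimal_nonempty_nibble G (edge_cut G B) \<and> e \<in> edge_cut G B \<and>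
    edge_cut G B \<subseteq> edges_between G (X - B) (B - X)"
proof -
  obtain x y where xy: "e \<in> gedges G" "gends G e = {x, y}" "x \<in> X" "y \<notin> X"
    using e unfolding edge_cut_def by blast
  let ?C = "component G X x"
  have C: "connected_set G ?C" "?C \<subseteq> X" "x \<in> ?C"
    using xy(3) by (simp_all add: connected_set_component component_subset component_self)
  have "(x, y) \<in> adj G" "y \<notin> ?C" using xy C(2) unfolding adj_def by blast+
  then obtain B where B: "B \<subseteq> gverts G - ?C" "y \<in> B" "\<forall>b\<in>B. component G (- ?C) b \<subseteq> B"
    "minimal_nonempty_nibble G (edge_cut G B)"
    using minimal_nibble_of_components[OF G nobean C(1) rayless_induced_subset[OF G X C(2)] C(3)]
    by metis
  have "e \<in> edge_cut G B" using in_edge_cut_iff[OF G xy(1,2)] B(1,2) C(3) by blast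
  moreover have "edge_cut G B \<subseteq> edges_between G ?C B"
    using B(1,3) by (intro edge_cut_union_of_components[OF G]) auto
  moreover have "edges_between G ?C B \<subseteq> edges_between G (X - B) (B - X)"
    using B(1) by (intro edges_between_component_outside[OF xy(3)]) blast
  ultimately show ?thesis using B(1,4) by blast
qed

section \<open>Digraphs\<close>

lemma underlying_simps:
  "gverts (underlying D) = verts D" "gedges (underlying D) = arcs D"
  "gends (underlying D) e = {tail D e, head D e}"
  by (simp_all add: underlying_def)

lemma wf_multigraph_underlying: "wf_digraph D \<Longrightarrow> wf_multigraph (underlying D)"
  by (auto simp: wf_multigraph_def underlying_simps wf_digraph_def)

lemma adj_underlying: "adj (underlying D) = arcs_ends D \<union> (arcs_ends D)\<inverse>"
  by (auto simp: adj_def underlying_simps arcs_ends_conv image_iff doubleton_eq_iff)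

lemma directed_cutI:
  assumes D: "wf_digraph D" and B: "B \<subseteq> verts D"
    and closed: "arcs_ends D `` X \<subseteq> X \<or> (arcs_ends D)\<inverse> `` X \<subseteq> X"
    and cut: "edge_cut (underlying D) B \<subseteq> edges_between (underlying D) (X - B) (B - X)"
  shows "directed_cut D (edge_cut (underlying D) B)"
proof -
  have ends: "e \<in> arcs D \<and>
      (tail D e \<in> X - B \<and> head D e \<in> B - X \<or> tail D e \<in> B - X \<and> head D e \<in> X - B)"
    if "e \<in> edge_cut (underlying D) B" for e
    using cut that by (auto simp: edges_between_def underlying_simps doubleton_eq_iff)
  have arc: "(tail D e, head D e) \<in> arcs_ends D" "tail D e \<in> verts D" "head D e \<in> verts D"
    if "e \<in> arcs D" for e
    using that D by (auto simp: arcs_ends_conv image_iff wf_digraph_def)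
  have "(\<forall>e\<in>edge_cut (underlying D) B. tail D e \<in> B \<and> head D e \<in> verts D - B) \<or>
      (\<forall>e\<in>edge_cut (underlying D) B. tail D e \<in> verts D - B \<and> head D e \<in> B)"
    using closed
  proof
    assume "arcs_ends D `` X \<subseteq> X"
    then have "tail D e \<in> X \<Longrightarrow> head D e \<in> X" if "e \<in> arcs D" for e
      using arc(1)[OF that] by blast
    then show ?thesis using ends arc(2,3) by (metis DiffD1 DiffD2 DiffI)
  next
    assume "(arcs_ends D)\<inverse> `` X \<subseteq> X"
    then have "head D e \<in> X \<Longrightarrow> tail D e \<in> X" if "e \<in> arcs D" for e
      using arc(1)[OF that] by blast
    then show ?thesis using ends arc(2,3) by (metis DiffD1 DiffD2 DiffI)
  qed
  then show ?thesis unfolding directed_cut_def using B by blast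
qed

lemma minimal_directed_nibble_through_arc:
  assumes D: "wf_digraph D" and nobean: "\<not> contains_subdivision (underlying D) bean_graph"
    and e: "e \<in> arcs D" "(tail D e \<in> X) \<noteq> (head D e \<in> X)"
    and closed: "arcs_ends D `` X \<subseteq> X \<or> (arcs_ends D)\<inverse> `` X \<subseteq> X"
    and X: "rayless (induced (underlying D) X)"
  shows "\<exists>F. minimal_nonempty_nibble (underlying D) F \<and> directed_cut D F \<and> e \<in> F"
proof -
  have G: "wf_multigraph (underlying D)" by (rule wf_multigraph_underlying[OF D])
  have "e \<in> edge_cut (underlying D) X"
    using e in_edge_cut_iff[OF G] by (simp add: underlying_simps)
  then obtain B where "B \<subseteq> verts D"
    "minimal_nonempty_nibble (underlying D) (edge_cut (underlying D) B)"
    "e \<in> edge_cut (underlying D) B"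
    "edge_cut (underlying D) B \<subseteq> edges_between (underlying D) (X - B) (B - X)"
    using minimal_nibble_in_rayless_cut[OF G nobean X] unfolding underlying_simps by blast
  then show ?thesis using directed_cutI[OF D _ closed] by blast
qed

lemma cycle_through_arc:
  assumes "wf_digraph D" "e \<in> arcs D" "tail D e \<in> (arcs_ends D)\<^sup>* `` {head D e}"
  shows "\<exists>c. pre_digraph.cycle D c \<and> e \<in> set c"
proof -
  interpret wf_digraph D by fact
  have "head D e \<rightarrow>\<^sup>*\<^bsub>D\<^esub> tail D e" using assms(2,3) by (auto simp: reachable_conv)
  then obtain p where "apath (head D e) p (tail D e)" unfolding reachable_apath by blast
  then have "awalk (tail D e) (e # p) (tail D e)" "distinct (tl (awalk_verts (tail D e) (e # p)))"
    using assms(2) by (auto simp: apath_def awalk_Cons_iff)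
  then have "cycle (e # p)" unfolding cycle_def by blast
  then show ?thesis by (intro exI[of _ "e # p"]) simp
qed

definition join_rays :: "(nat \<Rightarrow> 'a) \<Rightarrow> (nat \<Rightarrow> 'a) \<Rightarrow> int \<Rightarrow> 'a" where
  "join_rays b f i = (if 0 \<le> i then f (nat i) else b (nat (- i - 1)))"

lemma inj_join_rays:
  assumes "inj b" "inj f" "range b \<inter> range f = {}"
  shows "inj (join_rays b f)"
proof (rule injI)
  have "b i \<noteq> f j" "f j \<noteq> b i" for i j using assms(3) by blast+
  then show "i = j" if "join_rays b f i = join_rays b f j" for i j
    using that by (auto simp: join_rays_def inj_eq[OF assms(1)] inj_eq[OF assms(2)]
        split: if_splits)
qed

lemma join_rays_step:
  assumes b: "ray_in (E\<inverse>) b" and f: "ray_in E f" and bridge: "(b 0, f 0) \<in> E"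
  shows "(join_rays b f i, join_rays b f (i + 1)) \<in> E"
proof -
  consider (forward) "i \<ge> 0" | (link) "i = - 1" | (backward) "i < - 1" by linarith
  then show ?thesis
  proof cases
    case forward
    then show ?thesis using f by (simp add: join_rays_def ray_in_def nat_add_distrib)
  next
    case link
    then show ?thesis using bridge by (simp add: join_rays_def)
  next
    case backward
    define k where "k = nat (- i - 2)"
    have "nat (- i - 1) = Suc k" "nat (- (i + 1) - 1) = k" using backward by (simp_all add: k_def)
    then have "join_rays b f i = b (Suc k)" "join_rays b f (i + 1) = b k"
      using backward by (simp_all add: join_rays_def)
    then show ?thesis using b by (simp add: ray_in_def)
  qed
qed

lemma double_ray_through_arc:
  assumes D: "wf_digraph D" "e \<in> arcs D"
    and b: "ray_in ((arcs_ends D)\<inverse>) b" "b 0 = tail D e"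
    and f: "ray_in (arcs_ends D) f" "f 0 = head D e"
    and disj: "range b \<inter> range f = {}"
  shows "\<exists>r a. directed_double_ray D r a \<and> e \<in> range a"
proof -
  let ?r = "join_rays b f"
  have "(tail D e, head D e) \<in> arcs_ends D"
    using D(2) by (simp add: arcs_ends_conv)
  then have "(?r i, ?r (i + 1)) \<in> arcs_ends D" for i
    using join_rays_step[OF b(1) f(1)] b(2) f(2) by simp
  then have "\<exists>a. a \<in> arcs D \<and> tail D a = ?r i \<and> head D a = ?r (i + 1)" for i
    by (meson reachableE)
  then obtain a where a: "\<And>i. a i \<in> arcs D \<and> tail D (a i) = ?r i \<and> head D (a i) = ?r (i + 1)"
    by metis
  have "range ?r \<subseteq> verts D" using a wf_digraph.tail_in_verts[OF D(1)] by (metis image_subsetI)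
  moreover have "inj ?r" using b(1) f(1) disj by (simp add: ray_in_def inj_join_rays)
  moreover have "?r (- 1) = tail D e" "?r 0 = head D e"
    using b(2) f(2) by (simp_all add: join_rays_def)
  ultimately have "directed_double_ray D ?r (a(- 1 := e))"
    using a D(2) unfolding directed_double_ray_def by simp
  moreover have "e \<in> range (a(- 1 := e))" by (metis fun_upd_same rangeI)
  ultimately show ?thesis by blast
qed

lemma ray_from_if_reachable_ray:
  assumes G: "wf_multigraph G" and nobean: "\<not> contains_subdivision G bean_graph"
    and E: "E \<subseteq> adj G" and reach: "\<not> rayless (induced G (E\<^sup>* `` {x}))"
    and B: "\<not> rayless (induced G B)" "B \<inter> E\<^sup>* `` {x} = {}" "B \<subseteq> (adj G)\<^sup>* `` {x}"
  shows "\<exists>\<rho>. ray_in E \<rho> \<and> \<rho> 0 = x"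
proof -
  obtain r where r: "ray_in (adj G) r" "range r \<subseteq> E\<^sup>* `` {x}"
    using reach unfolding rayless_induced_iff[OF G] by blast
  obtain t where t: "ray_in (adj G) t" "range t \<subseteq> B"
    using B(1) unfolding rayless_induced_iff[OF G] by blast
  have "range r \<inter> E\<^sup>* `` {x} = range r" using r(2) by blast
  moreover have "infinite (range r)" using r(1) by (simp add: ray_in_def range_inj_infinite)
  moreover have "range t \<inter> E\<^sup>* `` {x} = {}" "(x, t 0) \<in> (adj G)\<^sup>*" using t(2) B(2,3) by blast+
  ultimately show ?thesis
    using ray_from_if_infinite_reachable[OF G nobean E subset_refl r _ t(1)] by simp
qed

lemma double_ray_if_rays_on_both_sides:
  assumes D: "wf_digraph D" and nobean: "\<not> contains_subdivision (underlying D) bean_graph"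
    and e: "e \<in> arcs D"
    and nocycle: "tail D e \<notin> (arcs_ends D)\<^sup>* `` {head D e}"
    and head: "\<not> rayless (induced (underlying D) ((arcs_ends D)\<^sup>* `` {head D e}))"
    and tail: "\<not> rayless (induced (underlying D) (((arcs_ends D)\<inverse>)\<^sup>* `` {tail D e}))"
  shows "\<exists>r a. directed_double_ray D r a \<and> e \<in> range a"
proof -
  let ?G = "underlying D" and ?A = "arcs_ends D"
  let ?X = "?A\<^sup>* `` {head D e}" and ?Y = "(?A\<inverse>)\<^sup>* `` {tail D e}"
  have G: "wf_multigraph ?G" by (rule wf_multigraph_underlying[OF D])
  have disj: "?X \<inter> ?Y = {}"
    using nocycle by (auto simp: rtrancl_converse intro: rtrancl_trans)
  have adj: "?A \<subseteq> adj ?G" "?A\<inverse> \<subseteq> adj ?G" by (auto simp: adj_underlying)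
  have "(tail D e, head D e) \<in> ?A" using e by (simp add: arcs_ends_conv)
  then have link: "(tail D e, head D e) \<in> adj ?G" "(head D e, tail D e) \<in> adj ?G"
    by (auto simp: adj_underlying)
  have "?Y \<subseteq> (adj ?G)\<^sup>* `` {head D e}"
    using rtrancl_mono[OF adj(2)] link(2) by (auto intro: converse_rtrancl_into_rtrancl)
  then obtain f where f: "ray_in ?A f" "f 0 = head D e"
    using ray_from_if_reachable_ray[OF G nobean adj(1) head tail] disj by blast
  have "?X \<subseteq> (adj ?G)\<^sup>* `` {tail D e}"
    using rtrancl_mono[OF adj(1)] link(1) by (auto intro: converse_rtrancl_into_rtrancl)
  then obtain b where b: "ray_in (?A\<inverse>) b" "b 0 = tail D e"
    using ray_from_if_reachable_ray[OF G nobean adj(2) tail head] disj by blast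
  have "range b \<inter> range f = {}"
    using ray_in_reachable[OF f(1)] ray_in_reachable[OF b(1)] disj unfolding f(2) b(2) by blast
  then show ?thesis by (rule double_ray_through_arc[OF D e b f])
qed

theorem theorem5p34:
  fixes D :: "('v, 'e) pre_digraph" and vw :: 'e
  assumes "wf_digraph D"
    and "\<not> contains_subdivision (underlying D) bean_graph"
    and "vw \<in> arcs D"
  shows "(\<exists>c. pre_digraph.cycle D c \<and> vw \<in> set c)
    \<or> (\<exists>r a. directed_double_ray D r a \<and> vw \<in> range a)
    \<or> (\<exists>F. minimal_nonempty_nibble (underlying D) F \<and> directed_cut D F \<and> vw \<in> F)"
proof -
  let ?A = "arcs_ends D" and ?rayless = "\<lambda>X. rayless (induced (underlying D) X)"
  let ?X = "?A\<^sup>* `` {head D vw}" and ?Y = "(?A\<inverse>)\<^sup>* `` {tail D vw}"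
  consider (cycle) "tail D vw \<in> ?X" | (X_rayless) "tail D vw \<notin> ?X" "?rayless ?X"
    | (Y_rayless) "tail D vw \<notin> ?X" "?rayless ?Y"
    | (rays) "tail D vw \<notin> ?X" "\<not> ?rayless ?X" "\<not> ?rayless ?Y"
    by blast
  then show ?thesis
  proof cases
    case cycle
    then show ?thesis using cycle_through_arc[OF assms(1,3)] by blast
  next
    case X_rayless
    moreover have "?A `` ?X \<subseteq> ?X" "head D vw \<in> ?X" by (auto intro: rtrancl_into_rtrancl)
    ultimately show ?thesis using minimal_directed_nibble_through_arc[OF assms, of ?X] by metis
  next
    case Y_rayless
    moreover have "?A\<inverse> `` ?Y \<subseteq> ?Y" "tail D vw \<in> ?Y" by (auto intro: rtrancl_into_rtrancl)
    moreover have "head D vw \<notin> ?Y" using Y_rayless(1) by (simp add: rtrancl_converse)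
    ultimately show ?thesis using minimal_directed_nibble_through_arc[OF assms, of ?Y] by metis
  next
    case rays
    then show ?thesis using double_ray_if_rays_on_both_sides[OF assms] by blast
  qed
qed

end
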